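(* Let $N\ge1$, let $\mu_p\in\mathbb R$ and $\alpha_p\in\mathbb R\setminus\{0\}$ for $p=1,\dots,N$, and let $\lambda_1,\lambda_2,\lambda_3>0$ be independent variables (principal stretches). Put $J=\lambda_1\lambda_2\lambda_3$ and $\tilde\lambda_a=J^{-1/3}\lambda_a$. Let $S_{\mathrm{ich}\,a}$, $a=1,2,3$, be the principal values of the isochoric second Piola-Kirchhoff stress of the Ogden model, regarded as functions of $(\lambda_1,\lambda_2,\lambda_3)$: $$S_{\mathrm{ich}\,a}=\frac1{\lambda_a^2}\left(\tilde\lambda_a\frac{\partial G_{\mathrm{ich}}}{\partial\tilde\lambda_a}-\frac13\sum_{b=1}^3\tilde\lambda_b\frac{\partial G_{\mathrm{ich}}}{\partial\tilde\lambda_b}\right),\qquad G_{\mathrm{ich}}(\tilde\lambda_1,\tilde\lambda_2,\tilde\lambda_3)=\sum_{a=1}^3\sum_{p=1}^N\frac{\mu_p}{\alpha_p}\left(\tilde\lambda_a^{\alpha_p}-1\right).$$ Then for all $a,b\in\{1,2,3\}$, $$\frac1{\lambda_b}\frac{\partial S_{\mathrm{ich}\,a}}{\partial\lambda_b}=\begin{cases}\displaystyle\lambda_a^{-4}\sum_{p=1}^N\mu_p\alpha_p\left(\Big(\frac13-\frac2{\alpha_p}\Big)\tilde\lambda_a^{\alpha_p}+\Big(\frac19+\frac2{3\alpha_p}\Big)\sum_{c=1}^3\tilde\lambda_c^{\alpha_p}\right), & a=b,\\[1.5em]\displaystyle\lambda_a^{-2}\lambda_b^{-2}\sum_{p=1}^N\mu_p\alpha_p\left(-\frac13\tilde\lambda_b^{\alpha_p}-\frac13\tilde\lambda_a^{\alpha_p}+\frac19\sum_{c=1}^3\tilde\lambda_c^{\alpha_p}\right),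 & a\ne b.\end{cases}$$
   Context: In the formula for $S_{\mathrm{ich}\,a}$, the partial derivatives $\partial G_{\mathrm{ich}}/\partial\tilde\lambda_a$ are taken treating $\tilde\lambda_1,\tilde\lambda_2,\tilde\lambda_3$ as independent arguments of $G_{\mathrm{ich}}$, so that $\partial G_{\mathrm{ich}}/\partial\tilde\lambda_a=\sum_{p=1}^N\mu_p\tilde\lambda_a^{\alpha_p-1}$; afterwards $\tilde\lambda_a=J^{-1/3}\lambda_a$ is substituted. The derivative $\partial/\partial\lambda_b$ in the conclusion is then taken with respect to the independent variables $\lambda_1,\lambda_2,\lambda_3$. These quantities are coefficients of the isochoric elasticity tensor $2\,\partial\boldsymbol S_{\mathrm{ich}}/\partial\boldsymbol C$ in the principal basis, where $\lambda_a^2$ are the eigenvalues of the right Cauchy-Green tensor $\boldsymbol C$. *)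

theory Defs
  imports "HOL-Analysis.Analysis"
begin

definition upd_component :: "real ^ 'n \<Rightarrow> 'n \<Rightarrow> real \<Rightarrow> real ^ 'n" where
  "upd_component x i t = (\<chi> k. if k = i then t else x $ k)"

definition partially_differentiable :: "'n \<Rightarrow> (real ^ 'n \<Rightarrow> real) \<Rightarrow> real ^ 'n \<Rightarrow> bool" where
  "partially_differentiable i f x \<longleftrightarrow>
     (\<lambda>t. f (upd_component x i t)) differentiable (at (x $ i))"

text \<open>As with \<^const>\<open>deriv\<close>, the value is meaningful only where the partial derivative exists.\<close>

definition partial_deriv :: "'n \<Rightarrow> (real ^ 'n \<Rightarrow> real) \<Rightarrow> real ^ 'n \<Rightarrow> real" where
  "partial_deriv i f x = deriv (\<lambda>t. f (upd_component x i t)) (x $ i)"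

definition volume_ratio :: "real ^ 3 \<Rightarrow> real" where
  "volume_ratio l = l $ 1 * l $ 2 * l $ 3"

definition iso_stretch :: "real ^ 3 \<Rightarrow> real ^ 3" where
  "iso_stretch l = (\<chi> a. volume_ratio l powr (- 1 / 3) * l $ a)"

definition G_ich :: "nat \<Rightarrow> (nat \<Rightarrow> real) \<Rightarrow> (nat \<Rightarrow> real) \<Rightarrow> real ^ 3 \<Rightarrow> real" where
  "G_ich N \<mu> \<alpha> m = (\<Sum>a\<in>UNIV. \<Sum>p=1..N. \<mu> p / \<alpha> p * ((m $ a) powr \<alpha> p - 1))"

text \<open>The derivatives of \<^term>\<open>G\<close> are taken in its three independent arguments; only afterwards
  are the isochoric stretches of \<^term>\<open>l\<close> substituted.\<close>

definition ich_principal_stress :: "(real ^ 3 \<Rightarrow> real) \<Rightarrow> 3 \<Rightarrow> real ^ 3 \<Rightarrow> real" where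
  "ich_principal_stress G a l =
     1 / (l $ a)\<^sup>2 *
       (iso_stretch l $ a * partial_deriv a G (iso_stretch l)
        - 1 / 3 * (\<Sum>b\<in>UNIV. iso_stretch l $ b * partial_deriv b G (iso_stretch l)))"

definition S_ich :: "nat \<Rightarrow> (nat \<Rightarrow> real) \<Rightarrow> (nat \<Rightarrow> real) \<Rightarrow> 3 \<Rightarrow> real ^ 3 \<Rightarrow> real" where
  "S_ich N \<mu> \<alpha> = ich_principal_stress (G_ich N \<mu> \<alpha>)"

end

theory Submission
  imports Defs
begin

text \<open>Along a variation of one stretch, the logarithmic derivative of the isochoric stretches is
  $\lambda_b\,\partial\log\tilde\lambda_c/\partial\lambda_b = \delta_{bc} - 1/3$. On the positive
  orthant $S_a = \lambda_a^{-2} \sum_p \mu_p (\tilde\lambda_a^{\alpha_p} - \frac13 \sum_c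
  \tilde\lambda_c^{\alpha_p})$, so the product rule gives all entries at once.\<close>

lemma upd_component_nth [simp]: "upd_component x i t $ k = (if k = i then t else x $ k)"
  by (simp add: upd_component_def)

lemma upd_component_same [simp]: "upd_component x i (x $ i) = x"
  by (simp add: vec_eq_iff)

lemma partial_deriv_eqI:
  assumes "((\<lambda>t. f (upd_component x i t)) has_real_derivative D) (at (x $ i))"
  shows "partial_deriv i f x = D"
  using assms unfolding partial_deriv_def by (rule DERIV_imp_deriv)

lemma partially_differentiableI:
  assumes "((\<lambda>t. f (upd_component x i t)) has_real_derivative D) (at (x $ i))"
  shows "partially_differentiable i f x"
  using assms unfolding partially_differentiable_def by (auto simp: real_differentiable_def)

text \<open>\<open>G_ich\<close> is a sum of functions of one argument each, so only the summand
  with index \<open>b\<close> varies. Its factor 1 / \<open>\<alpha> p\<close> cancels the exponent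
  brought down by the power rule, which is where \<open>\<alpha> p\<close> must be nonzero.\<close>

lemma partial_deriv_G_ich:
  assumes nz: "\<forall>p\<in>{1..N}. \<alpha> p \<noteq> 0" and pos: "m $ b > 0"
  shows "partial_deriv b (G_ich N \<mu> \<alpha>) m = (\<Sum>p=1..N. \<mu> p * (m $ b) powr (\<alpha> p - 1))"
proof (rule partial_deriv_eqI)
  have "((\<lambda>t. \<Sum>p=1..N. \<mu> p / \<alpha> p * ((if a = b then t else m $ a) powr \<alpha> p - 1))
      has_real_derivative (if a = b then \<Sum>p=1..N. \<mu> p * (m $ b) powr (\<alpha> p - 1) else 0))
      (at (m $ b))" for a
  proof (cases "a = b")
    case True
    show ?thesis
      unfolding if_P[OF True]
      by (rule DERIV_sum) (use pos nz in \<open>auto intro!: derivative_eq_intros\<close>)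
  qed simp
  then have "((\<lambda>t. \<Sum>a\<in>UNIV. \<Sum>p=1..N. \<mu> p / \<alpha> p * ((if a = b then t else m $ a) powr \<alpha> p - 1))
      has_real_derivative
        (\<Sum>a\<in>UNIV. if a = b then \<Sum>p=1..N. \<mu> p * (m $ b) powr (\<alpha> p - 1) else 0)) (at (m $ b))"
    by (intro DERIV_sum)
  then show "((\<lambda>t. G_ich N \<mu> \<alpha> (upd_component m b t)) has_real_derivative
      (\<Sum>p=1..N. \<mu> p * (m $ b) powr (\<alpha> p - 1))) (at (m $ b))"
    by (simp add: G_ich_def)
qed

lemma volume_ratio_pos: "(\<And>a. l $ a > 0) \<Longrightarrow> volume_ratio l > 0"
  by (simp add: volume_ratio_def)

lemma iso_stretch_pos:
  assumes "\<And>a. l $ a > 0"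
  shows "iso_stretch l $ a > 0"
  using volume_ratio_pos[OF assms] assms by (simp add: iso_stretch_def)

text \<open>Multiplying the partial derivative by its own stretch restores the exponent
  \<open>\<alpha> p\<close>. The resulting closed form contains no \<open>partial_deriv\<close> and
  can be differentiated directly.\<close>

lemma S_ich_eq:
  assumes nz: "\<forall>p\<in>{1..N}. \<alpha> p \<noteq> 0" and pos: "\<And>a. l $ a > 0"
  shows "S_ich N \<mu> \<alpha> a l = (\<Sum>p=1..N. \<mu> p *
    ((iso_stretch l $ a) powr \<alpha> p - 1 / 3 * (\<Sum>c\<in>UNIV. (iso_stretch l $ c) powr \<alpha> p)))
      / (l $ a)\<^sup>2"
proof -
  have "iso_stretch l $ c * partial_deriv c (G_ich N \<mu> \<alpha>) (iso_stretch l)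
      = (\<Sum>p=1..N. \<mu> p * (iso_stretch l $ c) powr \<alpha> p)" for c
    using iso_stretch_pos[OF pos, of c] nz
    by (subst partial_deriv_G_ich) (auto simp: sum_distrib_left powr_diff intro!: sum.cong)
  moreover have "(\<Sum>c\<in>UNIV. \<Sum>p=1..N. \<mu> p * (iso_stretch l $ c) powr \<alpha> p)
      = (\<Sum>p=1..N. \<mu> p * (\<Sum>c\<in>UNIV. (iso_stretch l $ c) powr \<alpha> p))"
    by (subst sum.swap) (simp add: sum_distrib_left)
  moreover have "(\<Sum>p=1..N. \<mu> p * (y p - 1 / 3 * X p))
      = (\<Sum>p=1..N. \<mu> p * y p) - 1 / 3 * (\<Sum>p=1..N. \<mu> p * X p)" for y X :: "nat \<Rightarrow> real"
    by (simp add: right_diff_distrib sum_subtractf sum_divide_distrib)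
  ultimately show ?thesis
    by (simp add: S_ich_def ich_principal_stress_def)
qed

text \<open>The volume ratio is linear in each single stretch, with slope J /
  \<open>l $ b\<close>.\<close>

lemma volume_ratio_upd_component:
  assumes "l $ b \<noteq> 0"
  shows "volume_ratio (upd_component l b t) = t * (volume_ratio l / l $ b)"
  using assms exhaust_3[of b] by (auto simp: volume_ratio_def)

text \<open>The factor J powr (-1/3) contributes the -1/3 and the factor \<open>l $ c\<close> the
  Kronecker delta. Writing the derivative as the value times a logarithmic derivative makes later
  powers cost only a factor \<open>r\<close>.\<close>

lemma iso_stretch_has_real_derivative:
  assumes pos: "\<And>a. l $ a > 0"
  shows "((\<lambda>t. iso_stretch (upd_component l b t) $ c) has_real_derivative
    iso_stretch l $ c / l $ b * (of_bool (c = b) - 1 / 3)) (at (l $ b))"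
proof -
  define J where "J = volume_ratio l"
  have J: "J > 0" and lb: "l $ b > 0"
    using volume_ratio_pos[OF pos] pos by (simp_all add: J_def)
  have "((\<lambda>t. (t * (J / l $ b)) powr (- 1 / 3)) has_real_derivative
      - 1 / 3 * J powr (- 1 / 3) / l $ b) (at (l $ b))"
    \<comment> \<open>The power rule leaves the exponent -1/3 - 1 = -4/3; the inner derivative J /
      \<open>l $ b\<close> supplies the factor J that raises it back to -1/3.\<close>
    using J lb powr_mult_base[of J "- (4 / 3)"]
    by (auto intro!: derivative_eq_intros simp: mult.commute)
  moreover have "((\<lambda>t. if c = b then t else l $ c) has_real_derivative of_bool (c = b)) (at (l $ b))"
    by simp
  ultimately have "((\<lambda>t. (t * (J / l $ b)) powr (- 1 / 3) * (if c = b then t else l $ c))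
      has_real_derivative
        - 1 / 3 * J powr (- 1 / 3) / l $ b * (if c = b then l $ b else l $ c)
        + of_bool (c = b) * (l $ b * (J / l $ b)) powr (- 1 / 3)) (at (l $ b))"
    by (rule DERIV_mult)
  moreover have "- 1 / 3 * J powr (- 1 / 3) / l $ b * (if c = b then l $ b else l $ c)
        + of_bool (c = b) * (l $ b * (J / l $ b)) powr (- 1 / 3)
      = iso_stretch l $ c / l $ b * (of_bool (c = b) - 1 / 3)"
    using lb by (auto simp: iso_stretch_def J_def field_simps)
  ultimately show ?thesis
    using lb by (simp add: iso_stretch_def volume_ratio_upd_component J_def)
qed

lemma iso_stretch_powr_has_real_derivative:
  assumes pos: "\<And>a. l $ a > 0"
  shows "((\<lambda>t. (iso_stretch (upd_component l b t) $ c) powr r) has_real_derivative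
    r * (iso_stretch l $ c) powr r / l $ b * (of_bool (c = b) - 1 / 3)) (at (l $ b))"
proof -
  have x: "iso_stretch l $ c > 0"
    by (rule iso_stretch_pos[OF pos])
  show ?thesis
    by (rule DERIV_cong[OF DERIV_fun_powr[OF iso_stretch_has_real_derivative[OF pos]]])
      (use x in \<open>simp_all add: powr_diff\<close>)
qed

text \<open>One formula for all pairs of indices: the first term differentiates the sum over
  \<open>p\<close>, the second the prefactor \<open>l $ a\<close> to the power -2, which varies only
  if \<open>a = b\<close>.\<close>

lemma S_ich_has_real_derivative:
  assumes nz: "\<forall>p\<in>{1..N}. \<alpha> p \<noteq> 0" and pos: "\<And>a. l $ a > 0"
  defines "x \<equiv> \<lambda>c p. (iso_stretch l $ c) powr \<alpha> p"
  shows "((\<lambda>t. S_ich N \<mu> \<alpha> a (upd_component l b t)) has_real_derivative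
    (\<Sum>p=1..N. \<mu> p * \<alpha> p * (x a p * (of_bool (a = b) - 1 / 3)
        - 1 / 3 * (x b p - 1 / 3 * (\<Sum>c\<in>UNIV. x c p)))) / (l $ b * (l $ a)\<^sup>2)
    - of_bool (a = b) * (2 * (\<Sum>p=1..N. \<mu> p * (x a p - 1 / 3 * (\<Sum>c\<in>UNIV. x c p))) / (l $ a) ^ 3))
    (at (l $ b))"
proof -
  let ?y = "\<lambda>t c. iso_stretch (upd_component l b t) $ c"
  let ?T = "\<lambda>t. \<Sum>p=1..N. \<mu> p * (?y t a powr \<alpha> p - 1 / 3 * (\<Sum>c\<in>UNIV. ?y t c powr \<alpha> p))"
  let ?D = "\<Sum>p=1..N. \<mu> p * \<alpha> p * (x a p * (of_bool (a = b) - 1 / 3)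
        - 1 / 3 * (x b p - 1 / 3 * (\<Sum>c\<in>UNIV. x c p)))"
  let ?S = "\<Sum>p=1..N. \<mu> p * (x a p - 1 / 3 * (\<Sum>c\<in>UNIV. x c p))"
  have la: "l $ a > 0" and lb: "l $ b > 0"
    using pos by auto
  \<comment> \<open>In the sum over \<open>c\<close> the Kronecker delta selects
    \<open>x b p\<close>, while the constant -1/3 keeps the full sum.\<close>
  have sum: "(\<Sum>c\<in>UNIV. \<alpha> p * x c p / l $ b * (of_bool (c = b) - 1 / 3))
      = \<alpha> p / l $ b * (x b p - 1 / 3 * (\<Sum>c\<in>UNIV. x c p))" for p
  proof -
    have "(\<Sum>c\<in>UNIV. \<alpha> p * x c p / l $ b * (of_bool (c = b) - 1 / 3))
        = \<alpha> p / l $ b * (\<Sum>c\<in>UNIV. x c p * of_bool (c = b) - 1 / 3 * x c p)"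
      unfolding sum_distrib_left by (intro sum.cong) (simp_all add: algebra_simps)
    then show ?thesis
      by (simp add: sum_subtractf sum_mult_of_bool_eq sum_divide_distrib)
  qed
  have "(?T has_real_derivative (\<Sum>p=1..N. \<mu> p * (\<alpha> p * x a p / l $ b * (of_bool (a = b) - 1 / 3)
      - 1 / 3 * (\<Sum>c\<in>UNIV. \<alpha> p * x c p / l $ b * (of_bool (c = b) - 1 / 3))))) (at (l $ b))"
    unfolding x_def
    by (intro DERIV_sum DERIV_cmult DERIV_diff iso_stretch_powr_has_real_derivative pos)
  also have "(\<Sum>p=1..N. \<mu> p * (\<alpha> p * x a p / l $ b * (of_bool (a = b) - 1 / 3)
      - 1 / 3 * (\<Sum>c\<in>UNIV. \<alpha> p * x c p / l $ b * (of_bool (c = b) - 1 / 3)))) = ?D / l $ b"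
    unfolding sum sum_divide_distrib using lb by (intro sum.cong) (auto simp: field_simps)
  finally have T: "(?T has_real_derivative ?D / l $ b) (at (l $ b))" .
  have sq: "((\<lambda>t. (upd_component l b t $ a)\<^sup>2) has_real_derivative of_bool (a = b) * (2 * l $ a))
      (at (l $ b))"
    by (auto intro!: derivative_eq_intros)
  \<comment> \<open>Stated for arbitrary reals, so that the sums over \<open>p\<close> stay opaque
    in the rearrangement.\<close>
  have quotient: "(D / l $ b * (l $ a)\<^sup>2 - S * (\<delta> * (2 * l $ a))) / ((l $ a)\<^sup>2 * (l $ a)\<^sup>2)
      = D / (l $ b * (l $ a)\<^sup>2) - \<delta> * (2 * S / (l $ a) ^ 3)" for D S \<delta> :: real
    using la lb by (simp add: field_simps power2_eq_square power3_eq_cube)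
  have "((\<lambda>t. ?T t / (upd_component l b t $ a)\<^sup>2) has_real_derivative
      (?D / l $ b * (l $ a)\<^sup>2 - ?S * (of_bool (a = b) * (2 * l $ a))) / ((l $ a)\<^sup>2 * (l $ a)\<^sup>2))
      (at (l $ b))"
    using DERIV_divide[OF T sq] la unfolding upd_component_same x_def by simp
  also have "(?D / l $ b * (l $ a)\<^sup>2 - ?S * (of_bool (a = b) * (2 * l $ a))) / ((l $ a)\<^sup>2 * (l $ a)\<^sup>2)
      = ?D / (l $ b * (l $ a)\<^sup>2) - of_bool (a = b) * (2 * ?S / (l $ a) ^ 3)"
    by (rule quotient)
  \<comment> \<open>The closed form of the stress is known only for positive stretches, so the
    derivative is transferred on the open half-line \<open>{0<..}\<close>, a neighbourhood of
    \<open>l $ b\<close>.\<close>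
  finally show ?thesis
  proof (rule has_field_derivative_transform_within_open)
    fix t :: real
    assume "t \<in> {0<..}"
    then have "upd_component l b t $ c > 0" for c
      using pos by auto
    from S_ich_eq[OF nz this]
    show "?T t / (upd_component l b t $ a)\<^sup>2 = S_ich N \<mu> \<alpha> a (upd_component l b t)"
      by simp
  qed (use lb in auto)
qed

theorem mainTheorem3:
  fixes N :: nat and \<mu> \<alpha> :: "nat \<Rightarrow> real" and l :: "real ^ 3"
  assumes "N \<ge> 1"
    and "\<And>p. p \<in> {1..N} \<Longrightarrow> \<alpha> p \<noteq> 0"
    and "\<And>a. l $ a > 0"
  shows "\<forall>a b.
    partially_differentiable b (S_ich N \<mu> \<alpha> a) l \<and>
    1 / (l $ b) * partial_deriv b (S_ich N \<mu> \<alpha> a) l =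
      (if a = b then
         (l $ a) powi (- 4) * (\<Sum>p=1..N. \<mu> p * \<alpha> p *
           ((1 / 3 - 2 / \<alpha> p) * (iso_stretch l $ a) powr \<alpha> p
            + (1 / 9 + 2 / (3 * \<alpha> p)) * (\<Sum>c\<in>UNIV. (iso_stretch l $ c) powr \<alpha> p)))
       else
         (l $ a) powi (- 2) * (l $ b) powi (- 2) * (\<Sum>p=1..N. \<mu> p * \<alpha> p *
           (- (1 / 3) * (iso_stretch l $ b) powr \<alpha> p
            - 1 / 3 * (iso_stretch l $ a) powr \<alpha> p
            + 1 / 9 * (\<Sum>c\<in>UNIV. (iso_stretch l $ c) powr \<alpha> p))))"
proof (intro allI conjI)
  fix a b
  have nz: "\<forall>p\<in>{1..N}. \<alpha> p \<noteq> 0"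
    using assms(2) by blast
  \<comment> \<open>This single fact gives both the existence of the partial derivative and its
    value.\<close>
  note D = S_ich_has_real_derivative[OF nz assms(3), where a = a and b = b and \<mu> = \<mu>]
  show "partially_differentiable b (S_ich N \<mu> \<alpha> a) l"
    by (rule partially_differentiableI[OF D])
  note deriv = partial_deriv_eqI[OF D]
  have la: "l $ a > 0" and lb: "l $ b > 0"
    using assms(3) by auto
  let ?x = "\<lambda>c p. (iso_stretch l $ c) powr \<alpha> p"
  let ?X = "\<lambda>p. \<Sum>c\<in>UNIV. ?x c p"
  show "1 / (l $ b) * partial_deriv b (S_ich N \<mu> \<alpha> a) l =
      (if a = b then
         (l $ a) powi (- 4) * (\<Sum>p=1..N. \<mu> p * \<alpha> p *
           ((1 / 3 - 2 / \<alpha> p) * ?x a p + (1 / 9 + 2 / (3 * \<alpha> p)) * ?X p))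
       else
         (l $ a) powi (- 2) * (l $ b) powi (- 2) * (\<Sum>p=1..N. \<mu> p * \<alpha> p *
           (- (1 / 3) * ?x b p - 1 / 3 * ?x a p + 1 / 9 * ?X p)))"
  proof (cases "a = b")
    case True
    have factor: "1 / (l $ b) * (D / (l $ b * (l $ b)\<^sup>2) - 2 * S / (l $ b) ^ 3)
        = (l $ b) powi (- 4) * (D - 2 * S)" for D S :: real
      using lb by (simp add: power_int_minus field_simps power2_eq_square power3_eq_cube
          power4_eq_xxxx)
    let ?D = "\<Sum>p=1..N. \<mu> p * \<alpha> p * (?x b p * (1 - 1 / 3) - 1 / 3 * (?x b p - 1 / 3 * ?X p))"
    let ?S = "\<Sum>p=1..N. \<mu> p * (?x b p - 1 / 3 * ?X p)"
    have "1 / (l $ b) * partial_deriv b (S_ich N \<mu> \<alpha> a) l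
        = 1 / (l $ b) * (?D / (l $ b * (l $ b)\<^sup>2) - 2 * ?S / (l $ b) ^ 3)"
      unfolding deriv using True by simp
    also have "\<dots> = (l $ b) powi (- 4) * (?D - 2 * ?S)"
      by (rule factor)
    \<comment> \<open>The terms of \<open>?D\<close> give the coefficients 2/3 - 1/3 = 1/3 and 1/9.
      Those of \<open>2 * ?S\<close> lack the factor \<open>\<alpha> p\<close>; extracting it, as
      \<open>\<alpha> p\<close> is nonzero, produces -2 / \<open>\<alpha> p\<close> and 2 / (3
      \<open>\<alpha> p\<close>).\<close>
    also have "?D - 2 * ?S = (\<Sum>p=1..N. \<mu> p * \<alpha> p *
           ((1 / 3 - 2 / \<alpha> p) * ?x b p + (1 / 9 + 2 / (3 * \<alpha> p)) * ?X p))"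
      unfolding sum_distrib_left[of 2] sum_subtractf[symmetric]
      using assms(2) by (intro sum.cong) (auto simp: field_simps)
    finally show ?thesis
      using True by simp
  next
    case False
    \<comment> \<open>Off the diagonal the prefactor is constant, and the outer 1 /
      \<open>l $ b\<close> completes the second inverse square.\<close>
    have factor: "1 / (l $ b) * (D / (l $ b * (l $ a)\<^sup>2))
        = (l $ a) powi (- 2) * (l $ b) powi (- 2) * D" for D :: real
      using la lb by (simp add: power_int_minus field_simps power2_eq_square)
    have "1 / (l $ b) * partial_deriv b (S_ich N \<mu> \<alpha> a) l
        = 1 / (l $ b) * ((\<Sum>p=1..N. \<mu> p * \<alpha> p *
           (?x a p * (0 - 1 / 3) - 1 / 3 * (?x b p - 1 / 3 * ?X p))) / (l $ b * (l $ a)\<^sup>2))"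
      unfolding deriv using False by simp
    also have "\<dots> = (l $ a) powi (- 2) * (l $ b) powi (- 2) * (\<Sum>p=1..N. \<mu> p * \<alpha> p *
           (?x a p * (0 - 1 / 3) - 1 / 3 * (?x b p - 1 / 3 * ?X p)))"
      by (rule factor)
    also have "(\<Sum>p=1..N. \<mu> p * \<alpha> p *
           (?x a p * (0 - 1 / 3) - 1 / 3 * (?x b p - 1 / 3 * ?X p)))
        = (\<Sum>p=1..N. \<mu> p * \<alpha> p * (- (1 / 3) * ?x b p - 1 / 3 * ?x a p + 1 / 9 * ?X p))"
      by (intro sum.cong) (auto simp: algebra_simps)
    finally show ?thesis
      using False by simp
  qed
qed

end
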